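(* For every connected simple graph $G$ of order at least $2$, $$\partial(G)\le \partial(\operatorname{S}(G))\le \partial(\operatorname{Q}(G)).$$
   Context: All graphs are finite. For a simple graph $H$ and $D\subseteq V(H)$, let $B_H(D)$ be the set of vertices in $V(H)\setminus D$ that have a neighbour in $D$, and let $\partial(D)=|B_H(D)|-|D|$. The differential of $H$ is $\partial(H)=\max\{\partial(D): D\subseteq V(H)\}$. For a simple graph $G$, the subdivision graph $\operatorname{S}(G)$ is the graph with vertex set the disjoint union $V(G)\cup E(G)$ in which $v\in V(G)$ and $e\in E(G)$ are adjacent if and only if $e$ is incident with $v$ in $G$, and there are no other edges. The graph $\operatorname{Q}(G)$ has the same vertex set $V(G)\cup E(G)$ and all the edges of $\operatorname{S}(G)$, and in addition two distinct elements $e,f\in E(G)$ are adjacent in $\operatorname{Q}(G)$ if and only if they share an endpoint in $G$. *)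

theory Defs
  imports Main
begin

record 'a graph =
  verts :: "'a set"
  edges :: "'a set set"

definition simple_graph :: "'a graph \<Rightarrow> bool" where
  "simple_graph G \<longleftrightarrow>
     finite (verts G) \<and> (\<forall>e\<in>edges G. e \<subseteq> verts G \<and> card e = 2)"

definition adj :: "'a graph \<Rightarrow> 'a \<Rightarrow> 'a \<Rightarrow> bool" where
  "adj G u v \<longleftrightarrow> {u, v} \<in> edges G"

definition connected_graph :: "'a graph \<Rightarrow> bool" where
  "connected_graph G \<longleftrightarrow>
     verts G \<noteq> {} \<and> (\<forall>u\<in>verts G. \<forall>v\<in>verts G. (adj G)\<^sup>*\<^sup>* u v)"

definition boundary :: "'a graph \<Rightarrow> 'a set \<Rightarrow> 'a set" where
  "boundary H D = {v \<in> verts H - D. \<exists>u\<in>D. adj H v u}"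

text \<open>Integer-valued, since the difference may be negative.\<close>

definition set_differential :: "'a graph \<Rightarrow> 'a set \<Rightarrow> int" where
  "set_differential H D = int (card (boundary H D)) - int (card D)"

definition differential :: "'a graph \<Rightarrow> int" where
  "differential H = Max (set_differential H ` Pow (verts H))"

text \<open>The disjoint union of vertices and edges lives in a sum type: \<open>Inl v\<close> is the
  vertex \<open>v\<close> of \<open>G\<close> and \<open>Inr e\<close> the edge \<open>e\<close> of \<open>G\<close>.\<close>

definition subdivision_graph :: "'a graph \<Rightarrow> ('a + 'a set) graph" where
  "subdivision_graph G =
     \<lparr>verts = verts G <+> edges G,
      edges = {{Inl v, Inr e} | v e. v \<in> verts G \<and> e \<in> edges G \<and> v \<in> e}\<rparr>"

definition Q_graph :: "'a graph \<Rightarrow> ('a + 'a set) graph" where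
  "Q_graph G =
     \<lparr>verts = verts (subdivision_graph G),
      edges = edges (subdivision_graph G) \<union>
        {{Inr e, Inr f} | e f. e \<in> edges G \<and> f \<in> edges G \<and> e \<noteq> f \<and> e \<inter> f \<noteq> {}}\<rparr>"

lemma simple_graph_finite_edges:
  assumes "simple_graph G"
  shows "finite (edges G)"
proof -
  have "edges G \<subseteq> Pow (verts G)" "finite (verts G)"
    using assms by (auto simp: simple_graph_def)
  then show ?thesis by (meson finite_Pow_iff finite_subset)
qed

lemma simple_graph_subdivision:
  "simple_graph G \<Longrightarrow> simple_graph (subdivision_graph G)"
  using simple_graph_finite_edges[of G]
  by (auto simp: simple_graph_def subdivision_graph_def)

lemma simple_graph_Q:
  "simple_graph G \<Longrightarrow> simple_graph (Q_graph G)"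
  using simple_graph_finite_edges[of G]
  by (auto simp: simple_graph_def subdivision_graph_def Q_graph_def card_insert_if)

end

theory Submission
  imports Defs
begin

text \<open>Both inequalities compare vertex sets one at a time: it suffices to turn each vertex set of
  the graph on the left into a vertex set of the same size, in the graph on the right, whose
  boundary is at least as large. For \<open>\<partial>(G) \<le> \<partial>(S(G))\<close> the set \<open>D\<close> is reused unchanged. A vertex
  \<open>b\<close> outside \<open>D\<close> with a neighbour in \<open>D\<close> selects an edge from \<open>b\<close> into \<open>D\<close>, and \<open>b\<close> is the only
  end of that edge outside \<open>D\<close>, so different \<open>b\<close> select different edges; in \<open>S(G)\<close> the selected
  edges are boundary vertices of \<open>D\<close> (\<open>card_boundary_le_subdivision\<close>). For
  \<open>\<partial>(S(G)) \<le> \<partial>(Q(G))\<close> one only adds edges on a fixed vertex set, which never removes a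
  vertex from a boundary (\<open>boundary_mono\<close>).\<close>

lemma differential_leI:
  assumes "finite (verts H)" "finite (verts K)"
    and dominated: "\<And>D. D \<subseteq> verts H \<Longrightarrow>
      \<exists>D'\<subseteq>verts K. set_differential H D \<le> set_differential K D'"
  shows "differential H \<le> differential K"
proof -
  have "set_differential H D \<le> differential K" if "D \<subseteq> verts H" for D
  proof -
    obtain D' where "D' \<subseteq> verts K" "set_differential H D \<le> set_differential K D'"
      using dominated[OF \<open>D \<subseteq> verts H\<close>] by blast
    moreover have "set_differential K D' \<le> differential K"
      unfolding differential_def using \<open>D' \<subseteq> verts K\<close> \<open>finite (verts K)\<close>
      by (intro Max_ge) auto
    ultimately show ?thesis by simp
  qed
  then show ?thesis
    unfolding differential_def[of H] using \<open>finite (verts H)\<close>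
    by (subst Max_le_iff) auto
qed

lemma boundary_mono:
  assumes "verts H = verts K" "edges H \<subseteq> edges K"
  shows "boundary H D \<subseteq> boundary K D"
  using assms by (auto simp: boundary_def adj_def)

lemma finite_boundary: "finite (verts H) \<Longrightarrow> finite (boundary H D)"
  by (simp add: boundary_def)

lemma edge_in_subdivision_boundary:
  assumes "e \<in> edges G" "u \<in> e" "u \<in> D" "D \<subseteq> verts G"
  shows "Inr e \<in> boundary (subdivision_graph G) (Inl ` D)"
proof -
  have "adj (subdivision_graph G) (Inr e) (Inl u)"
    using assms by (auto simp: adj_def subdivision_graph_def)
  then show ?thesis
    using assms by (auto simp: boundary_def subdivision_graph_def)
qed

text \<open>The injection sends a boundary vertex \<open>b\<close> to a chosen edge \<open>{b, f b}\<close> with \<open>f b \<in> D\<close>; it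
  can be undone because \<open>b\<close> is recovered as the end of that edge outside \<open>D\<close>.\<close>

lemma card_boundary_le_subdivision:
  assumes "simple_graph G" "D \<subseteq> verts G"
  shows "card (boundary G D) \<le> card (boundary (subdivision_graph G) (Inl ` D))"
proof -
  have "\<forall>b\<in>boundary G D. \<exists>u. u \<in> D \<and> {b, u} \<in> edges G"
    by (auto simp: boundary_def adj_def)
  then obtain f where f: "\<And>b. b \<in> boundary G D \<Longrightarrow> f b \<in> D \<and> {b, f b} \<in> edges G"
    by metis
  have "inj_on (\<lambda>b. Inr {b, f b} :: 'a + 'a set) (boundary G D)"
  proof (rule inj_onI)
    fix b c
    assume bc: "b \<in> boundary G D" "c \<in> boundary G D"
      and "(Inr {b, f b} :: 'a + 'a set) = Inr {c, f c}"
    then have "b \<in> {c, f c}" by auto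
    moreover have "b \<noteq> f c" using bc f by (auto simp: boundary_def)
    ultimately show "b = c" by simp
  qed
  moreover have "(\<lambda>b. Inr {b, f b}) ` boundary G D
      \<subseteq> boundary (subdivision_graph G) (Inl ` D)"
    using f edge_in_subdivision_boundary[OF _ _ _ assms(2)] by blast
  moreover have "finite (boundary (subdivision_graph G) (Inl ` D))"
    using simple_graph_subdivision[OF assms(1)]
    by (simp add: simple_graph_def finite_boundary)
  ultimately show ?thesis by (rule card_inj_on_le)
qed

theorem proposition2p24:
  fixes G :: "'a graph"
  assumes "simple_graph G"
    and "connected_graph G"
    and "card (verts G) \<ge> 2"
  shows "differential G \<le> differential (subdivision_graph G) \<and>
         differential (subdivision_graph G) \<le> differential (Q_graph G)"
proof
  have fin: "finite (verts G)" "finite (verts (subdivision_graph G))" "finite (verts (Q_graph G))"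
    using assms(1) simple_graph_subdivision[OF assms(1)] simple_graph_Q[OF assms(1)]
    by (simp_all add: simple_graph_def)
  show "differential G \<le> differential (subdivision_graph G)"
  proof (rule differential_leI[OF fin(1,2)])
    fix D assume D: "D \<subseteq> verts G"
    have "set_differential G D \<le> set_differential (subdivision_graph G) (Inl ` D)"
      using card_boundary_le_subdivision[OF assms(1) D]
      by (simp add: set_differential_def card_image)
    moreover have "Inl ` D \<subseteq> verts (subdivision_graph G)"
      using D by (auto simp: subdivision_graph_def)
    ultimately show "\<exists>D'\<subseteq>verts (subdivision_graph G).
        set_differential G D \<le> set_differential (subdivision_graph G) D'"
      by blast
  qed
  show "differential (subdivision_graph G) \<le> differential (Q_graph G)"
  proof (rule differential_leI[OF fin(2,3)])
    fix D assume D: "D \<subseteq> verts (subdivision_graph G)"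
    have "boundary (subdivision_graph G) D \<subseteq> boundary (Q_graph G) D"
      by (rule boundary_mono) (auto simp: Q_graph_def)
    then have "set_differential (subdivision_graph G) D \<le> set_differential (Q_graph G) D"
      using card_mono[OF finite_boundary[OF fin(3)]] by (simp add: set_differential_def)
    moreover have "D \<subseteq> verts (Q_graph G)"
      using D by (simp add: Q_graph_def)
    ultimately show "\<exists>D'\<subseteq>verts (Q_graph G).
        set_differential (subdivision_graph G) D \<le> set_differential (Q_graph G) D'"
      by blast
  qed
qed

end
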